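(* Let $\mathcal{L}$ be a finite relational language with no unary relation symbols, let $\mathbf{K}$ be an infinite $\mathcal{L}$-structure, and let $d$ be a positive integer. Suppose that every substructure of $\mathbf{K}$ of cardinality $d$ has finite big Ramsey degree in $\mathbf{K}$. Then there is a finite list of $d$-ary relations on $\mathbf{K}$ up to restriction; that is, there is a finite set $\mathcal{R}$ of $d$-ary relations on $\mathbf{K}$ such that for every $d$-ary relation $R$ on $\mathbf{K}$ there are $\tilde R\in\mathcal{R}$ and $\mathbf{K}'\in\binom{\mathbf{K}}{\mathbf{K}}$ with $R\upharpoonright\mathbf{K}'=\tilde R\upharpoonright\mathbf{K}'$.
   Context: A relational structure is a set together with relations of finite arity; the same symbol denotes a structure and its universe. An embedding of $\mathbf{A}$ into $\mathbf{B}$ (structures in the same relational signature) is an injection $f$ such that for every relation symbol $R$, $R^{\mathbf{A}}(a_1,\dots,a_n)\iff R^{\mathbf{B}}(f(a_1),\dots,f(a_n))$. A copy of $\mathbf{A}$ in $\mathbf{B}$ is the image of an embedding of $\mathbf{A}$ into $\mathbf{B}$, and $\binom{\mathbf{B}}{\mathbf{A}}$ is the set of copies of $\mathbf{A}$ in $\mathbf{B}$. For an infinite structure $\mathbf{K}$ and a finite substructure $\mathbf{A}$ of $\mathbf{K}$, the big Ramsey degree $t(\mathbf{A},\mathbf{K})$, if it exists, is the smallest integer $t$ such that for every $k\in\omega$ and every $c:\binom{\mathbf{K}}{\mathbf{A}}\to k$ there is $\mathbf{K}'\in\binom{\mathbf{K}}{\mathbf{K}}$ with $\left|c\left[\binom{\mathbf{K}'}{\mathbf{A}}\right]\right|\le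 t$; if it exists, $\mathbf{A}$ is said to have finite big Ramsey degree in $\mathbf{K}$. For a $d$-ary relation $R$ on $\mathbf{K}$, $R\upharpoonright\mathbf{K}'=R\cap(\mathbf{K}')^d$. *)

theory Defs
  imports Main "HOL-Library.FuncSet"
begin

record 's lang =
  symbols :: "'s set"
  arity :: "'s \<Rightarrow> nat"

record ('s, 'a) struct =
  universe :: "'a set"
  interp :: "'s \<Rightarrow> 'a list set"

text \<open>The set \<open>S\<^sup>n\<close>; \<open>n\<close>-tuples are lists of length \<open>n\<close>, possibly with repeated entries.\<close>

definition tuples :: "nat \<Rightarrow> 'a set \<Rightarrow> 'a list set" where
  "tuples n S = {xs. length xs = n \<and> set xs \<subseteq> S}"

definition relation_on :: "nat \<Rightarrow> 'a set \<Rightarrow> 'a list set \<Rightarrow> bool" where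
  "relation_on n S R \<longleftrightarrow> R \<subseteq> tuples n S"

definition restrict_rel :: "nat \<Rightarrow> 'a list set \<Rightarrow> 'a set \<Rightarrow> 'a list set" where
  "restrict_rel n R S = R \<inter> tuples n S"

definition is_structure :: "'s lang \<Rightarrow> ('s, 'a) struct \<Rightarrow> bool" where
  "is_structure L A \<longleftrightarrow>
     (\<forall>s\<in>symbols L. relation_on (arity L s) (universe A) (interp A s))"

definition embedding ::
  "'s lang \<Rightarrow> ('s, 'a) struct \<Rightarrow> ('s, 'b) struct \<Rightarrow> ('a \<Rightarrow> 'b) \<Rightarrow> bool" where
  "embedding L A B f \<longleftrightarrow>
     f \<in> universe A \<rightarrow> universe B \<and> inj_on f (universe A) \<and>
     (\<forall>s\<in>symbols L. \<forall>xs\<in>tuples (arity L s) (universe A).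
        xs \<in> interp A s \<longleftrightarrow> map f xs \<in> interp B s)"

text \<open>A copy is represented by its universe, a subset of \<open>universe B\<close>; where it is needed as a
  structure, it is turned into one by \<open>substruct\<close>.\<close>

definition copies ::
  "'s lang \<Rightarrow> ('s, 'a) struct \<Rightarrow> ('s, 'b) struct \<Rightarrow> 'b set set" where
  "copies L A B = {f ` universe A | f. embedding L A B f}"

definition substruct ::
  "'s lang \<Rightarrow> ('s, 'a) struct \<Rightarrow> 'a set \<Rightarrow> ('s, 'a) struct" where
  "substruct L K S =
     \<lparr>universe = S, interp = (\<lambda>s. restrict_rel (arity L s) (interp K s) S)\<rparr>"

definition big_ramsey_bound ::
  "'s lang \<Rightarrow> ('s, 'a) struct \<Rightarrow> ('s, 'b) struct \<Rightarrow> nat \<Rightarrow> bool" where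
  "big_ramsey_bound L A K t \<longleftrightarrow>
     (\<forall>k::nat. \<forall>c \<in> copies L A K \<rightarrow> {..<k}.
        \<exists>K' \<in> copies L K K. card (c ` copies L A (substruct L K K')) \<le> t)"

definition is_big_ramsey_degree ::
  "'s lang \<Rightarrow> ('s, 'a) struct \<Rightarrow> ('s, 'b) struct \<Rightarrow> nat \<Rightarrow> bool" where
  "is_big_ramsey_degree L A K t \<longleftrightarrow>
     big_ramsey_bound L A K t \<and> (\<forall>t'. big_ramsey_bound L A K t' \<longrightarrow> t \<le> t')"

definition finite_big_ramsey_degree ::
  "'s lang \<Rightarrow> ('s, 'a) struct \<Rightarrow> ('s, 'b) struct \<Rightarrow> bool" where
  "finite_big_ramsey_degree L A K \<longleftrightarrow> (\<exists>t. is_big_ramsey_degree L A K t)"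

end

theory Submission imports Defs begin

text \<open>Since there are only finitely many isomorphism types of \<open>d\<close>-element substructures, the
  hypothesis yields one number \<open>t\<close> such that every finite colouring of all \<open>d\<close>-subsets of \<open>K\<close> takes
  at most \<open>t\<close> colours on some copy of \<open>K\<close>. Colouring a \<open>d\<close>-subset by the set of colours of the tuples
  inside it transfers this to finite colourings of \<open>d\<close>-tuples, repeated entries included. For the
  least bound \<open>t\<close> for tuples there is a colouring \<open>p\<close> taking at least \<open>t\<close> colours on every copy.
  Given \<open>R\<close>, colour a tuple by its \<open>p\<close>-colour together with its membership in \<open>R\<close>; on a copy where
  this takes at most \<open>t\<close> values, membership in \<open>R\<close> is a function of \<open>p\<close>. So the finitely many unions
  of colour classes of \<open>p\<close> suffice.\<close>

section \<open>Tuples, embeddings and copies\<close>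

lemma map_in_tuples: "f \<in> S \<rightarrow> T \<Longrightarrow> xs \<in> tuples n S \<Longrightarrow> map f xs \<in> tuples n T"
  by (auto simp: tuples_def)

lemma tuples_mono: "S \<subseteq> T \<Longrightarrow> tuples n S \<subseteq> tuples n T"
  by (auto simp: tuples_def)

lemma finite_tuples: "finite S \<Longrightarrow> finite (tuples n S)"
  using finite_lists_length_eq[of S n] by (simp add: tuples_def conj_commute)

lemma card_tuples: "finite S \<Longrightarrow> card (tuples n S) = card S ^ n"
  using card_lists_length_eq[of S n] by (simp add: tuples_def conj_commute)

lemma embedding_comp:
  assumes "embedding L A B f" and "embedding L B C g"
  shows "embedding L A C (g \<circ> f)"
  unfolding embedding_def
proof (intro conjI ballI)
  have f: "f \<in> universe A \<rightarrow> universe B" "inj_on f (universe A)"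
    and g: "g \<in> universe B \<rightarrow> universe C" "inj_on g (universe B)"
    using assms by (auto simp: embedding_def)
  show "g \<circ> f \<in> universe A \<rightarrow> universe C" using f g by auto
  show "inj_on (g \<circ> f) (universe A)"
    using f g by (intro comp_inj_on) (auto intro: inj_on_subset)
  fix s xs assume s: "s \<in> symbols L" and xs: "xs \<in> tuples (arity L s) (universe A)"
  then show "(xs \<in> interp A s) = (map (g \<circ> f) xs \<in> interp C s)"
    using assms map_in_tuples[OF f(1) xs] by (auto simp: embedding_def)
qed

lemma embedding_id: "embedding L A A id"
  by (auto simp: embedding_def)

lemma embedding_substruct_iff:
  assumes "T \<subseteq> universe K"
  shows "embedding L A (substruct L K T) f \<longleftrightarrow> embedding L A K f \<and> f ` universe A \<subseteq> T"
proof -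
  have "map f xs \<in> tuples n T" if "f ` universe A \<subseteq> T" "xs \<in> tuples n (universe A)" for xs n
    using that by (intro map_in_tuples) auto
  moreover have "f \<in> universe A \<rightarrow> T \<longleftrightarrow> f \<in> universe A \<rightarrow> universe K \<and> f ` universe A \<subseteq> T"
    using assms by auto
  ultimately show ?thesis
    by (auto simp: embedding_def substruct_def restrict_rel_def)
qed

text \<open>This lets every count of colours run over the copies in \<open>K\<close> that lie inside
  \<open>T\<close>, with no induced structure left to handle.\<close>

lemma copies_substruct:
  assumes "T \<subseteq> universe K"
  shows "copies L A (substruct L K T) = {S \<in> copies L A K. S \<subseteq> T}"
  using embedding_substruct_iff[OF assms, of L A] by (auto simp: copies_def)

lemma copies_subset: "S \<in> copies L A K \<Longrightarrow> S \<subseteq> universe K"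
  by (auto simp: copies_def embedding_def)

lemma card_copies: "S \<in> copies L A K \<Longrightarrow> card S = card (universe A)"
  by (auto simp: copies_def embedding_def card_image)

lemma copies_infinite: "S \<in> copies L A K \<Longrightarrow> infinite (universe A) \<Longrightarrow> infinite S"
  by (auto simp: copies_def embedding_def finite_image_iff)

lemma copies_self: "universe K \<in> copies L K K"
  unfolding copies_def using embedding_id by (intro CollectI exI[of _ id]) auto

lemma image_in_copies:
  assumes "S \<in> copies L A B" and f: "embedding L B C f"
  shows "f ` S \<in> copies L A C"
proof -
  obtain e where e: "embedding L A B e" "S = e ` universe A"
    using assms(1) by (auto simp: copies_def)
  have "f ` S = (f \<circ> e) ` universe A" by (simp add: e(2) image_comp)
  then show ?thesis using embedding_comp[OF e(1) f] unfolding copies_def by blast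
qed

text \<open>An embedding \<open>e\<close> with image in that of \<open>f\<close> can be followed by
  the inverse of \<open>f\<close>, which preserves relations in both directions on its domain. Hence
  colouring the copies inside the image of \<open>f\<close> is the same as colouring the copies in
  \<open>B\<close>.\<close>

lemma copies_in_image:
  assumes S: "S \<in> copies L A C" and f: "embedding L B C f" and sub: "S \<subseteq> f ` universe B"
  obtains S' where "S' \<in> copies L A B" and "S = f ` S'"
proof -
  obtain e where e: "embedding L A C e" and Se: "S = e ` universe A"
    using S by (auto simp: copies_def)
  define h where "h = inv_into (universe B) f \<circ> e"
  have "e x \<in> f ` universe B" if "x \<in> universe A" for x
    using that sub unfolding Se by blast
  then have fh: "f (h x) = e x" and hB: "h x \<in> universe B" if "x \<in> universe A" for x
    using that by (simp_all add: h_def f_inv_into_f inv_into_into)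
  have "embedding L A B h"
    unfolding embedding_def
  proof (intro conjI ballI)
    show hf: "h \<in> universe A \<rightarrow> universe B" using hB by auto
    show "inj_on h (universe A)"
      using e fh unfolding embedding_def inj_on_def by metis
    fix s xs assume s: "s \<in> symbols L" and xs: "xs \<in> tuples (arity L s) (universe A)"
    have "map f (map h xs) = map e xs"
      using xs fh by (auto simp: tuples_def)
    moreover have "map h xs \<in> interp B s \<longleftrightarrow> map f (map h xs) \<in> interp C s"
      using f s map_in_tuples[OF hf xs] unfolding embedding_def by blast
    moreover have "xs \<in> interp A s \<longleftrightarrow> map e xs \<in> interp C s"
      using e s xs unfolding embedding_def by blast
    ultimately show "xs \<in> interp A s \<longleftrightarrow> map h xs \<in> interp B s" by metis
  qed
  moreover have "S = f ` (h ` universe A)"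
    using fh unfolding Se by (simp add: image_image)
  ultimately show ?thesis using that unfolding copies_def by blast
qed

section \<open>Finitely many isomorphism types of \<open>d\<close>-element substructures\<close>

text \<open>The isomorphism type of the substructure enumerated by \<open>es\<close>, read off on indices.\<close>

definition index_type :: "'s lang \<Rightarrow> ('s, 'a) struct \<Rightarrow> 'a list \<Rightarrow> 's \<Rightarrow> nat list set" where
  "index_type L K es = restrict
     (\<lambda>s. {is \<in> tuples (arity L s) {..<length es}. map ((!) es) is \<in> interp K s}) (symbols L)"

text \<open>The witness \<open>f\<close> sends each element of \<open>es\<close> to the entry of
  \<open>es'\<close> at the same position. Whether a tuple is in a relation depends only on its
  positions, and there the two index types agree.\<close>

lemma index_type_eq_imp_copy:
  assumes es: "distinct es" "set es \<subseteq> universe K"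
    and es': "distinct es'" "set es' \<subseteq> universe K"
    and len: "length es = length es'"
    and eq: "index_type L K es = index_type L K es'"
  shows "set es' \<in> copies L (substruct L K (set es)) K"
proof -
  define i where "i = inv_into {..<length es} ((!) es)"
  define f where "f = (!) es' \<circ> i"
  have bij: "bij_betw ((!) es) {..<length es} (set es)"
    using es(1) by (intro bij_betw_nth) auto
  have bij': "bij_betw ((!) es') {..<length es} (set es')"
    using es'(1) len by (intro bij_betw_nth) auto
  have i: "bij_betw i (set es) {..<length es}"
    unfolding i_def using bij by (rule bij_betw_inv_into)
  have f: "bij_betw f (set es) (set es')"
    unfolding f_def using i bij' by (rule bij_betw_trans)
  have ei: "es ! i x = x" if "x \<in> set es" for x
    using bij_betw_inv_into_right[OF bij that] by (simp add: i_def)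
  have "embedding L (substruct L K (set es)) K f"
    unfolding embedding_def
  proof (intro conjI ballI)
    show "f \<in> universe (substruct L K (set es)) \<rightarrow> universe K"
      using bij_betw_imp_surj_on[OF f] es'(2) by (auto simp: substruct_def)
    show "inj_on f (universe (substruct L K (set es)))"
      using bij_betw_imp_inj_on[OF f] by (simp add: substruct_def)
    fix s xs
    assume s: "s \<in> symbols L"
      and "xs \<in> tuples (arity L s) (universe (substruct L K (set es)))"
    then have xs: "xs \<in> tuples (arity L s) (set es)" by (simp add: substruct_def)
    have "map i xs \<in> tuples (arity L s) {..<length es}"
      using bij_betw_imp_surj_on[OF i] by (intro map_in_tuples[OF _ xs]) auto
    moreover have "map i xs \<in> index_type L K es s \<longleftrightarrow> map i xs \<in> index_type L K es' s"
      by (simp add: eq)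
    ultimately have
      "map ((!) es) (map i xs) \<in> interp K s \<longleftrightarrow> map ((!) es') (map i xs) \<in> interp K s"
      using s len by (simp add: index_type_def del: map_map)
    moreover have "map ((!) es) (map i xs) = xs"
      using xs ei by (auto simp: tuples_def subset_iff intro!: map_idI)
    moreover have "map ((!) es') (map i xs) = map f xs" by (simp add: f_def)
    ultimately have "xs \<in> interp K s \<longleftrightarrow> map f xs \<in> interp K s" by metis
    then show "xs \<in> interp (substruct L K (set es)) s \<longleftrightarrow> map f xs \<in> interp K s"
      using xs by (simp add: substruct_def restrict_rel_def)
  qed
  moreover have "set es' = f ` universe (substruct L K (set es))"
    using bij_betw_imp_surj_on[OF f] by (simp add: substruct_def)
  ultimately show ?thesis unfolding copies_def by blast
qed

lemma finitely_many_substructure_types: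
  assumes "finite (symbols L)" and d: "d > 0"
  obtains \<Theta> where "finite \<Theta>" and "\<And>A. A \<in> \<Theta> \<Longrightarrow> A \<subseteq> universe K \<and> card A = d"
    and "\<And>S. S \<subseteq> universe K \<Longrightarrow> card S = d \<Longrightarrow> \<exists>A\<in>\<Theta>. S \<in> copies L (substruct L K A) K"
proof -
  define E where "E = {es. distinct es \<and> set es \<subseteq> universe K \<and> length es = d}"
  \<comment> \<open>The \<open>restrict\<close> in \<open>index_type\<close> fixes the value outside
    the symbols of \<open>L\<close>, so index types lie in a finite product.\<close>
  have "index_type L K ` E \<subseteq> PiE (symbols L) (\<lambda>s. Pow (tuples (arity L s) {..<d}))"
    by (auto simp: index_type_def E_def PiE_def)
  moreover have "finite (PiE (symbols L) (\<lambda>s. Pow (tuples (arity L s) {..<d})))"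
    using assms(1) by (intro finite_PiE) (auto intro: finite_tuples)
  ultimately have "finite (index_type L K ` E)" by (rule finite_subset)
  \<comment> \<open>The finite set \<open>F\<close> of enumerations represents every index type that
    occurs.\<close>
  then obtain F where F: "F \<subseteq> E" "finite F" "index_type L K ` F = index_type L K ` E"
    by (metis finite_subset_image subset_refl)
  show ?thesis
  proof (rule that[of "set ` F"])
    show "finite (set ` F)" using F by simp
    show "A \<subseteq> universe K \<and> card A = d" if "A \<in> set ` F" for A
      using that F(1) by (auto simp: E_def distinct_card)
    fix S assume S: "S \<subseteq> universe K" "card S = d"
    then have "finite S" using d by (auto intro: card_ge_0_finite)
    then obtain es' where es': "set es' = S" "distinct es'"
      using finite_distinct_list by blast
    then have "es' \<in> E" using S by (auto simp: E_def distinct_card)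
    then obtain es where "es \<in> F" "index_type L K es = index_type L K es'"
      using F(3) by (metis (no_types, lifting) imageE imageI)
    then show "\<exists>A\<in>set ` F. S \<in> copies L (substruct L K A) K"
      using index_type_eq_imp_copy[of es K es' L] F(1) \<open>es' \<in> E\<close> es'(1) by (auto simp: E_def)
  qed
qed

section \<open>Colourings of \<open>d\<close>-subsets\<close>

text \<open>The structures are treated one after another. Given a good copy \<open>K1\<close> for
  \<Theta>, the image of \<open>K\<close> under \<open>f\<close>, the colouring is pulled back along
  \<open>f\<close>; a copy \<open>K2\<close> good for \<open>A\<close> is then carried into
  \<open>K1\<close> by \<open>f\<close>. Passing to a smaller copy keeps the earlier bounds.\<close>

lemma simultaneous_big_ramsey_bound:
  assumes "finite \<Theta>"
    and bound: "\<And>A. A \<in> \<Theta> \<Longrightarrow> big_ramsey_bound L A K (t A)"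
    and c: "\<And>A. A \<in> \<Theta> \<Longrightarrow> c \<in> copies L A K \<rightarrow> {..<k::nat}"
  shows "\<exists>K'\<in>copies L K K. \<forall>A\<in>\<Theta>. card (c ` {S \<in> copies L A K. S \<subseteq> K'}) \<le> t A"
  using assms
proof (induction \<Theta> rule: finite_induct)
  case empty
  then show ?case using copies_self by blast
next
  case (insert A \<Theta>)
  then obtain K1 where K1: "K1 \<in> copies L K K"
    and K1_bound: "\<And>B. B \<in> \<Theta> \<Longrightarrow> card (c ` {S \<in> copies L B K. S \<subseteq> K1}) \<le> t B"
    by auto
  obtain f where f: "embedding L K K f" and K1f: "K1 = f ` universe K"
    using K1 by (auto simp: copies_def)
  have inj: "inj_on f (universe K)" using f by (simp add: embedding_def)
  have "(\<lambda>S. c (f ` S)) \<in> copies L A K \<rightarrow> {..<k}"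
    using insert.prems(2)[of A] image_in_copies[OF _ f] by auto
  moreover have "big_ramsey_bound L A K (t A)" by (rule insert.prems(1)) simp
  ultimately have "\<exists>K2\<in>copies L K K.
      card ((\<lambda>S. c (f ` S)) ` copies L A (substruct L K K2)) \<le> t A"
    unfolding big_ramsey_bound_def by blast
  then obtain K2 where K2: "K2 \<in> copies L K K"
    and "card ((\<lambda>S. c (f ` S)) ` copies L A (substruct L K K2)) \<le> t A"
    by (elim bexE)
  then have K2_bound: "card ((\<lambda>S. c (f ` S)) ` {S \<in> copies L A K. S \<subseteq> K2}) \<le> t A"
    using copies_substruct[OF copies_subset[OF K2]] by metis
  have K2_sub: "K2 \<subseteq> universe K" using K2 by (rule copies_subset)
  have "f ` K2 \<in> copies L K K" using K2 f by (rule image_in_copies)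
  moreover have "card (c ` {S \<in> copies L A K. S \<subseteq> f ` K2}) \<le> t A"
  proof -
    have "c S \<in> (\<lambda>S. c (f ` S)) ` {S \<in> copies L A K. S \<subseteq> K2}"
      if S: "S \<in> copies L A K" "S \<subseteq> f ` K2" for S
    proof -
      have "S \<subseteq> f ` universe K" using S(2) K2_sub by blast
      then obtain S' where S': "S' \<in> copies L A K" "S = f ` S'"
        using copies_in_image[OF S(1) f] by blast
      \<comment> \<open>Injectivity of \<open>f\<close> turns containment of images into
        containment.\<close>
      then have "S' \<subseteq> K2"
        using inj copies_subset[OF S'(1)] K2_sub S(2) by (fastforce dest: inj_onD)
      then show ?thesis using S' by blast
    qed
    then have sub: "c ` {S \<in> copies L A K. S \<subseteq> f ` K2}
        \<subseteq> (\<lambda>S. c (f ` S)) ` {S \<in> copies L A K. S \<subseteq> K2}"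
      by blast
    have "(\<lambda>S. c (f ` S)) ` {S \<in> copies L A K. S \<subseteq> K2} \<subseteq> {..<k}"
      using \<open>(\<lambda>S. c (f ` S)) \<in> copies L A K \<rightarrow> {..<k}\<close> by blast
    then show ?thesis
      using card_mono[OF finite_subset[OF _ finite_lessThan] sub] K2_bound by (meson order_trans)
  qed
  moreover have "card (c ` {S \<in> copies L B K. S \<subseteq> f ` K2}) \<le> t B" if B: "B \<in> \<Theta>" for B
  proof -
    have "c ` {S \<in> copies L B K. S \<subseteq> K1} \<subseteq> {..<k}"
      using insert.prems(2)[of B] B by blast
    moreover have "c ` {S \<in> copies L B K. S \<subseteq> f ` K2} \<subseteq> c ` {S \<in> copies L B K. S \<subseteq> K1}"
      unfolding K1f using K2_sub by blast
    ultimately show ?thesis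
      using K1_bound[OF B] card_mono[OF finite_subset[OF _ finite_lessThan]]
      by (meson order_trans)
  qed
  ultimately show ?case by auto
qed

text \<open>Every \<open>d\<close>-subset is a copy of one of finitely many structures, so the sum
  of their bounds works for all \<open>d\<close>-subsets at once.\<close>

lemma subsets_bounded_colours:
  assumes "finite (symbols L)" and d: "d > 0"
    and deg: "\<And>S. S \<subseteq> universe K \<Longrightarrow> card S = d \<Longrightarrow>
           finite_big_ramsey_degree L (substruct L K S) K"
  shows "\<exists>t. \<forall>k::nat. \<forall>c \<in> {S. S \<subseteq> universe K \<and> card S = d} \<rightarrow> {..<k}.
           \<exists>K'\<in>copies L K K. card (c ` {S. S \<subseteq> K' \<and> card S = d}) \<le> t"
proof -
  obtain \<Theta> where \<Theta>: "finite \<Theta>" "\<And>A. A \<in> \<Theta> \<Longrightarrow> A \<subseteq> universe K \<and> card A = d"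
    and cover: "\<And>S. S \<subseteq> universe K \<Longrightarrow> card S = d \<Longrightarrow>
      \<exists>A\<in>\<Theta>. S \<in> copies L (substruct L K A) K"
    using finitely_many_substructure_types[OF assms(1) d] by blast
  define \<Theta>' where "\<Theta>' = substruct L K ` \<Theta>"
  have fin: "finite \<Theta>'" using \<Theta>(1) by (simp add: \<Theta>'_def)
  have "\<forall>A\<in>\<Theta>'. finite_big_ramsey_degree L A K"
    using deg \<Theta>(2) by (auto simp: \<Theta>'_def)
  then have "\<forall>A\<in>\<Theta>'. \<exists>t. big_ramsey_bound L A K t"
    unfolding finite_big_ramsey_degree_def is_big_ramsey_degree_def by meson
  then obtain t where t: "\<And>A. A \<in> \<Theta>' \<Longrightarrow> big_ramsey_bound L A K (t A)" by metis
  have "card (universe A) = d" if "A \<in> \<Theta>'" for A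
    using that \<Theta>(2) by (auto simp: \<Theta>'_def substruct_def)
  then have copies_d: "S \<subseteq> universe K \<and> card S = d" if "A \<in> \<Theta>'" "S \<in> copies L A K" for A S
    using that copies_subset[of S L A K] card_copies[of S L A K] by simp
  show ?thesis
  proof (intro exI allI ballI)
    fix k :: nat and c assume c: "c \<in> {S. S \<subseteq> universe K \<and> card S = d} \<rightarrow> {..<k}"
    have cA: "c \<in> copies L A K \<rightarrow> {..<k}" if "A \<in> \<Theta>'" for A
      using c copies_d[OF that] by blast
    obtain K' where K': "K' \<in> copies L K K"
      and b: "\<And>A. A \<in> \<Theta>' \<Longrightarrow> card (c ` {S \<in> copies L A K. S \<subseteq> K'}) \<le> t A"
      using simultaneous_big_ramsey_bound[where c=c and k=k, OF fin t cA] by blast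
    have "c ` {S. S \<subseteq> K' \<and> card S = d} \<subseteq> (\<Union>A\<in>\<Theta>'. c ` {S \<in> copies L A K. S \<subseteq> K'})"
      using cover copies_subset[OF K'] unfolding \<Theta>'_def by blast
    moreover have "finite (\<Union>A\<in>\<Theta>'. c ` {S \<in> copies L A K. S \<subseteq> K'})"
      using cA by (intro finite_UN_I fin finite_subset[OF _ finite_lessThan[of k]]) blast
    ultimately have "card (c ` {S. S \<subseteq> K' \<and> card S = d})
        \<le> card (\<Union>A\<in>\<Theta>'. c ` {S \<in> copies L A K. S \<subseteq> K'})"
      by (intro card_mono)
    also have "\<dots> \<le> (\<Sum>A\<in>\<Theta>'. card (c ` {S \<in> copies L A K. S \<subseteq> K'}))"
      using fin by (rule card_UN_le)
    also have "\<dots> \<le> (\<Sum>A\<in>\<Theta>'. t A)" using b by (rule sum_mono)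
    finally show "\<exists>K'\<in>copies L K K. card (c ` {S. S \<subseteq> K' \<and> card S = d}) \<le> (\<Sum>A\<in>\<Theta>'. t A)"
      using K' by blast
  qed
qed

section \<open>From \<open>d\<close>-subsets to \<open>d\<close>-tuples\<close>

text \<open>Colouring \<open>S\<close> by the set \<open>V S\<close> of colours of its tuples leaves
  at most \<open>t\<close> such sets on some copy, and each has at most \<open>d ^ d\<close>
  elements because \<open>S\<close> carries that many tuples.\<close>

lemma tuples_bounded_colours:
  assumes inf: "infinite (universe K)" and d: "d > 0"
    and t: "\<And>(k::nat) c. c \<in> {S. S \<subseteq> universe K \<and> card S = d} \<rightarrow> {..<k} \<Longrightarrow>
           \<exists>K'\<in>copies L K K. card (c ` {S. S \<subseteq> K' \<and> card S = d}) \<le> t"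
    and c: "c \<in> tuples d (universe K) \<rightarrow> {..<k::nat}"
  shows "\<exists>K'\<in>copies L K K. card (c ` tuples d K') \<le> t * d ^ d"
proof -
  define V where "V S = c ` tuples d S" for S
  \<comment> \<open>The bound \<open>t\<close> speaks of natural numbers as colours, so
    \<open>h\<close> codes sets of colours injectively by an initial segment.\<close>
  obtain h n where h: "inj_on h (Pow {..<k})" "h ` Pow {..<k} = {i. i < (n::nat)}"
    using finite_imp_inj_to_nat_seg[of "Pow {..<k}"] by auto
  have VP: "V S \<in> Pow {..<k}" if "S \<subseteq> universe K" for S
    using c tuples_mono[OF that, of d] by (auto simp: V_def)
  then have "h \<circ> V \<in> {S. S \<subseteq> universe K \<and> card S = d} \<rightarrow> {..<n}"
    using h(2) by (auto simp: Pi_iff lessThan_def)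
  then obtain K' where K': "K' \<in> copies L K K"
    and hV: "card ((h \<circ> V) ` {S. S \<subseteq> K' \<and> card S = d}) \<le> t"
    using t by blast
  define W where "W = V ` {S. S \<subseteq> K' \<and> card S = d}"
  have WP: "W \<subseteq> Pow {..<k}" using VP copies_subset[OF K'] unfolding W_def by blast
  then have finW: "finite W" by (rule finite_subset) simp
  have "card (h ` W) = card W"
    using inj_on_subset[OF h(1) WP] by (rule card_image)
  then have W_le: "card W \<le> t" using hV by (simp add: W_def image_comp)
  have "c ` tuples d K' \<subseteq> \<Union>W"
  proof
    fix y assume "y \<in> c ` tuples d K'"
    then obtain xs where xs: "xs \<in> tuples d K'" "y = c xs" by blast
    have "card (set xs) \<le> d" using xs(1) card_length[of xs] by (auto simp: tuples_def)
    \<comment> \<open>Repeated entries may leave fewer than \<open>d\<close> elements; the infinite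
      \<open>K'\<close> supplies the missing ones.\<close>
    moreover obtain B where B: "finite B" "card B = d - card (set xs)" "B \<subseteq> K' - set xs"
      using infinite_arbitrarily_large[OF Diff_infinite_finite[OF _ copies_infinite[OF K' inf]],
          of "set xs" "d - card (set xs)"] by auto
    ultimately have "card (set xs \<union> B) = d"
      using card_Un_disjoint[of "set xs" B] by auto
    moreover define S where "S = set xs \<union> B"
    ultimately have "set xs \<subseteq> S" "S \<subseteq> K'" "card S = d"
      using xs(1) B(3) by (auto simp: tuples_def)
    then have "xs \<in> tuples d S" "V S \<in> W" using xs by (auto simp: tuples_def W_def)
    then show "y \<in> \<Union>W" using xs(2) by (auto simp: V_def)
  qed
  moreover have "finite (\<Union>W)" using WP by (intro finite_subset[of "\<Union>W" "{..<k}"]) auto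
  ultimately have "card (c ` tuples d K') \<le> card (\<Union>W)" by (intro card_mono)
  also have "\<dots> \<le> (\<Sum>X\<in>W. card X)" by (rule card_Union_le_sum_card)
  also have "\<dots> \<le> (\<Sum>X\<in>W. d ^ d)"
  proof (rule sum_mono)
    fix X assume "X \<in> W"
    then obtain S where S: "card S = d" "X = c ` tuples d S" by (auto simp: W_def V_def)
    then have "finite S" using d by (auto intro: card_ge_0_finite)
    then show "card X \<le> d ^ d"
      using card_image_le[OF finite_tuples, of S c d] card_tuples[of S d] S by simp
  qed
  also have "\<dots> \<le> t * d ^ d" using W_le by simp
  finally show ?thesis using K' by blast
qed

section \<open>Relations as unions of colour classes\<close>

text \<open>The first projection maps the finite set of colour pairs onto a set that is no smaller,
  hence it is injective.\<close>

lemma colour_determines_of_card_le: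
  fixes p q :: "'a \<Rightarrow> nat"
  assumes fin: "finite ((\<lambda>x. (p x, q x)) ` X)"
    and le: "card ((\<lambda>x. (p x, q x)) ` X) \<le> card (p ` X)"
    and "x \<in> X" "y \<in> X" "p x = p y"
  shows "q x = q y"
proof -
  have "fst ` (\<lambda>x. (p x, q x)) ` X = p ` X" by (simp add: image_image)
  then have "inj_on fst ((\<lambda>x. (p x, q x)) ` X)"
    using fin le card_image_le[OF fin, of fst] by (intro eq_card_imp_inj_on) auto
  then have "(p x, q x) = (p y, q y)"
  proof (rule inj_onD)
    show "fst (p x, q x) = fst (p y, q y)" using assms(5) by simp
  qed (use assms(3,4) in blast)+
  then show ?thesis by simp
qed

theorem theorem1p1:
  fixes L :: "'s lang" and K :: "('s, 'a) struct" and d :: nat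
  assumes "finite (symbols L)"
    and "\<forall>s\<in>symbols L. arity L s \<noteq> 1"
    and "is_structure L K"
    and "infinite (universe K)"
    and "d > 0"
    and "\<And>S. S \<subseteq> universe K \<Longrightarrow> card S = d \<Longrightarrow>
           finite_big_ramsey_degree L (substruct L K S) K"
  shows "\<exists>\<R> :: 'a list set set. finite \<R> \<and>
           (\<forall>R\<in>\<R>. relation_on d (universe K) R) \<and>
           (\<forall>R. relation_on d (universe K) R \<longrightarrow>
              (\<exists>R'\<in>\<R>. \<exists>K'\<in>copies L K K.
                 restrict_rel d R K' = restrict_rel d R' K'))"
proof -
  define T where "T = tuples d (universe K)"
  define bnd where "bnd t \<longleftrightarrow> (\<forall>k::nat. \<forall>c \<in> T \<rightarrow> {..<k}.
    \<exists>K'\<in>copies L K K. card (c ` tuples d K') \<le> t)" for t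
  obtain t0 where "\<And>(k::nat) c. c \<in> {S. S \<subseteq> universe K \<and> card S = d} \<rightarrow> {..<k} \<Longrightarrow>
           \<exists>K'\<in>copies L K K. card (c ` {S. S \<subseteq> K' \<and> card S = d}) \<le> t0"
    using subsets_bounded_colours[OF assms(1,5,6)] by blast
  then have "bnd (t0 * d ^ d)"
    unfolding bnd_def T_def using tuples_bounded_colours[OF assms(4,5)] by blast
  then obtain t where t: "bnd t" and least: "\<And>t'. t' < t \<Longrightarrow> \<not> bnd t'"
    using exists_least_iff[of bnd] by blast
  \<comment> \<open>If \<open>t\<close> is positive, its predecessor is not a bound, and a colouring
    refuting it serves as \<open>p\<close>. If \<open>t\<close> is zero, a constant colouring
    does.\<close>
  obtain p and k :: nat where p: "p \<in> T \<rightarrow> {..<k}"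
    and p_many: "\<And>K'. K' \<in> copies L K K \<Longrightarrow> t \<le> card (p ` tuples d K')"
  proof (cases t)
    case 0
    then show ?thesis using that[of "\<lambda>_. 0" 1] by auto
  next
    case (Suc t')
    then have "\<not> bnd t'" using least by simp
    then show ?thesis using that Suc unfolding bnd_def by (metis not_less_eq_eq)
  qed
  \<comment> \<open>There is one relation for each set of \<open>p\<close>-colours; it depends only
    on \<open>p\<close> and \<open>k\<close>, which are chosen before \<open>R\<close>.\<close>
  define \<R> where "\<R> = (\<lambda>\<Phi>. {xs \<in> T. p xs \<in> \<Phi>}) ` Pow {..<k}"
  show ?thesis
  proof (intro exI conjI allI ballI impI)
    show "finite \<R>" by (simp add: \<R>_def)
    show "relation_on d (universe K) R" if "R \<in> \<R>" for R
      using that by (auto simp: \<R>_def relation_on_def T_def)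
    fix R :: "'a list set"
    define q :: "'a list \<Rightarrow> nat" where "q xs = (if xs \<in> R then 1 else 0)" for xs
    \<comment> \<open>This codes the pair of \<open>p xs\<close> and \<open>q xs\<close> as one
      number below \<open>2 * k\<close>; quotient and remainder by 2 recover it.\<close>
    define c where "c xs = 2 * p xs + q xs" for xs
    have q2: "q xs < 2" for xs by (simp add: q_def)
    have "c xs < 2 * k" if "xs \<in> T" for xs
      using p that q2[of xs] by (fastforce simp: c_def Pi_iff)
    then obtain K' where K': "K' \<in> copies L K K" and cK': "card (c ` tuples d K') \<le> t"
      using t unfolding bnd_def by (metis Pi_I lessThan_iff)
    have sub: "tuples d K' \<subseteq> T"
      unfolding T_def using K' by (intro tuples_mono copies_subset)
    have fin: "finite (c ` tuples d K')"
      using \<open>\<And>xs. xs \<in> T \<Longrightarrow> c xs < 2 * k\<close> sub by (intro finite_subset[OF _ finite_lessThan]) auto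
    have pq: "(\<lambda>xs. (p xs, q xs)) ` X = (\<lambda>n. (n div 2, n mod 2)) ` c ` X" for X
      using q2 by (auto simp: image_image c_def intro!: image_cong)
    have det: "q xs = q ys" if "xs \<in> tuples d K'" "ys \<in> tuples d K'" "p xs = p ys" for xs ys
    proof (rule colour_determines_of_card_le[OF _ _ that])
      show "finite ((\<lambda>xs. (p xs, q xs)) ` tuples d K')" unfolding pq using fin by simp
      \<comment> \<open>At most \<open>t\<close> pairs occur on \<open>K'\<close>, while
        \<open>p\<close> alone takes at least \<open>t\<close> colours there.\<close>
      show "card ((\<lambda>xs. (p xs, q xs)) ` tuples d K') \<le> card (p ` tuples d K')"
        unfolding pq using card_image_le[OF fin] cK' p_many[OF K'] by (meson order_trans)
    qed
    \<comment> \<open>These are the colours met by \<open>R\<close> inside \<open>K'\<close>. By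
      \<open>det\<close>, a tuple in \<open>K'\<close> with such a colour belongs to
      \<open>R\<close>.\<close>
    define \<Phi> where "\<Phi> = p ` (R \<inter> tuples d K')"
    have "xs \<in> R" if "xs \<in> tuples d K'" "p xs \<in> \<Phi>" for xs
    proof -
      obtain ys where "ys \<in> R" "ys \<in> tuples d K'" "p xs = p ys"
        using \<open>p xs \<in> \<Phi>\<close> by (auto simp: \<Phi>_def)
      then show ?thesis using det[OF that(1), of ys] by (simp add: q_def split: if_splits)
    qed
    then have "xs \<in> R \<longleftrightarrow> p xs \<in> \<Phi>" if "xs \<in> tuples d K'" for xs
      using that by (auto simp: \<Phi>_def)
    then have "restrict_rel d R K' = restrict_rel d {xs \<in> T. p xs \<in> \<Phi>} K'"
      using sub by (auto simp: restrict_rel_def)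
    moreover have "{xs \<in> T. p xs \<in> \<Phi>} \<in> \<R>"
      unfolding \<R>_def \<Phi>_def using p sub by (intro imageI) auto
    ultimately show "\<exists>R'\<in>\<R>. \<exists>K'\<in>copies L K K. restrict_rel d R K' = restrict_rel d R' K'"
      using K' by blast
  qed
qed

end
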